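(* Consider the problem $\min_{x\in\Omega}P(x)=f(x)+h(x)$ with $f=\frac1n\sum_{i=1}^n f_i$, $\Omega\subseteq\mathbb{R}^d$ convex, $h$ convex (possibly nonsmooth), the $f_i$ possibly nonconvex, and let $x^*$ be an optimal solution. Suppose the algorithm AsyLPG (described in the context) is run with $S$ epochs of $m$ inner iterations each, $T=Sm$, initial point $x^0$, gradient bit number $b$, model bit number $b_x$ and quantization constant $\mu>0$. Assume: (1) the index $a\in\{1,\dots,n\}$ sampled at each inner iteration satisfies $\mathbf{E}_a[\nabla f_a(x)]=\nabla f(x)$, and the random variables in different iterations are independent; (2) each $f_i$ is $L$-Lipschitz smooth: $\|\nabla f_i(x)-\nabla f_i(y)\|\le L\|x-y\|$ for all $x,y\in\Omega$; (3) the delay is bounded: $t-D(t)\le\tau$ for all $t$, for a finite constant $\tau>0$. Let $\Delta=\frac{d}{4(2^{b-1}-1)^2}$ and let the step size be $\eta=\frac{\rho}{L}$, where $\rho\in(0,\frac12)$ and $\rho,\tau$ satisfy $$8\rho^2m^2(\mu+1)(\Delta+2)+2\rho^2(\mu+1)(\Delta+2)\tau^2+\rho\le 1 .$$ Then the output $x_{out}$ of AsyLPG satisfies $$\mathbf{E}\|G_\eta(x_{out})\|^2\le\frac{2L\,(P(x^0)-P(x^* ))}{\rho(1-2\rho)T},$$ where $G_\eta(x)=\frac1\eta\big[x-\mathrm{prox}_{\eta h}(x-\eta\nabla f(x))\big]$ is the gradient mapping.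
   Context: Notation: $\|\cdot\|$ is the Euclidean norm, $\|\cdot\|_\infty$ the max norm. $\mathrm{prox}_{\eta h}(x)=\arg\min_{y\in\Omega}\, h(y)+\frac{1}{2\eta}\|y-x\|^2$. $\mathbf{E}$ is expectation over all randomness of the algorithm. Quantization: for $\delta\ge 0$ and an integer $b\ge 2$, $\mathrm{dom}(\delta,b)=\{-2^{b-1}\delta,\dots,-\delta,0,\delta,\dots,(2^{b-1}-1)\delta\}$. For real $x$: if $x\in[z,z+\delta]$ with $z,z+\delta\in\mathrm{dom}(\delta,b)$, then $Q_{(\delta,b)}(x)=z+\delta$ with probability $\frac{x-z}{\delta}$ and $=z$ with probability $\frac{z+\delta-x}{\delta}$; otherwise $Q_{(\delta,b)}(x)$ is the point of $\mathrm{dom}(\delta,b)$ closest to $x$. (If $\delta=0$ it outputs $0$.) For a vector, each coordinate is quantized independently with the same $(\delta,b)$. Algorithm AsyLPG. Set $\tilde x^0=x^0\in\Omega$. For $s=0,\dots,S-1$: set $x_0^{s+1}=\tilde x^s$ and compute the full gradient $\nabla f(\tilde x^s)$. For $t=0,\dots,m-1$: - An index $D(t)$ with $0\le D(t)\le t$ is given (asynchronous delay). With $\delta_x=\|x^{s+1}_{D(t)}\|_\infty/(2^{b_x-1}-1)$, form $Q_{(\delta_x,b_x)}(x^{s+1}_{D(t)})$; the quantization is required to satisfy $$\mathbf{E}_Q\|Q_{(\delta_x,b_x)}(x_{D(t)}^{s+1})-x_{D(t)}^{s+1}\|^2\le\mu\|x_{D(t)}^{s+1}-\tilde x^s\|^2,$$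 where $\mathbf{E}_Q$ is over the quantization randomness. (If $x^{s+1}_{D(t)}=\tilde x^s$, the exact $\tilde x^s$ is used in place of the quantized vector, so the constraint holds.) - Sample $a\in\{1,\dots,n\}$ and compute $\alpha_t=\nabla f_a(Q_{(\delta_x,b_x)}(x^{s+1}_{D(t)}))-\nabla f_a(\tilde x^s)$. - With $\delta_{\alpha_t}=\|\alpha_t\|_\infty/(2^{b-1}-1)$, set $u_t^{s+1}=Q_{(\delta_{\alpha_t},b)}(\alpha_t)+\nabla f(\tilde x^s)$ and $x_{t+1}^{s+1}=\mathrm{prox}_{\eta h}(x_t^{s+1}-\eta u_t^{s+1})$. At the end of the epoch set $\tilde x^{s+1}=x_m^{s+1}$. The output $x_{out}$ is chosen uniformly at random from $\{x_t^{s+1}:0\le t\le m-1,\ 0\le s\le S-1\}$. The quantized model vectors at which gradients are evaluated are treated as points of $\Omega$. *)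

theory Defs
  imports "HOL-Probability.Probability" "HOL-Probability.Product_PMF" "HOL-Library.Monad_Syntax"
begin

section \<open>Objective, proximal operator, gradient mapping\<close>

definition grad :: "('a::real_inner \<Rightarrow> real) \<Rightarrow> 'a \<Rightarrow> 'a" where
  "grad F x = (THE g. GDERIV F x :> g)"

definition avg :: "nat \<Rightarrow> (nat \<Rightarrow> 'a \<Rightarrow> real) \<Rightarrow> 'a \<Rightarrow> real" where
  "avg n f x = (1 / real n) * (\<Sum>i = 1..n. f i x)"

definition prox_objective ::
    "real \<Rightarrow> ('a::real_normed_vector \<Rightarrow> real) \<Rightarrow> 'a \<Rightarrow> 'a \<Rightarrow> real" where
  "prox_objective \<eta> h x y = h y + 1 / (2 * \<eta>) * (norm (y - x))\<^sup>2"

definition prox ::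
    "'a set \<Rightarrow> real \<Rightarrow> ('a::real_normed_vector \<Rightarrow> real) \<Rightarrow> 'a \<Rightarrow> 'a" where
  "prox \<Omega> \<eta> h x = arg_min_on (prox_objective \<eta> h x) \<Omega>"

definition grad_mapping ::
    "'a set \<Rightarrow> real \<Rightarrow> ('a::real_inner \<Rightarrow> real) \<Rightarrow> ('a \<Rightarrow> real) \<Rightarrow> 'a \<Rightarrow> 'a" where
  "grad_mapping \<Omega> \<eta> f h x = (1 / \<eta>) *\<^sub>R (x - prox \<Omega> \<eta> h (x - \<eta> *\<^sub>R grad f x))"

section \<open>Randomized quantization\<close>

definition quant_dom :: "real \<Rightarrow> nat \<Rightarrow> real set" where
  "quant_dom \<delta> b = (\<lambda>k::int. of_int k * \<delta>) ` {- (2 ^ (b - 1)) .. 2 ^ (b - 1) - 1}"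

text \<open>
  If \<open>x\<close> is itself a grid point, two cells may contain it; both give the point mass at \<open>x\<close>,
  so the choice of \<open>z\<close> below is irrelevant. The parameter \<open>\<delta>\<close> is meant to be nonnegative.
\<close>

definition quantize_real :: "real \<Rightarrow> nat \<Rightarrow> real \<Rightarrow> real pmf" where
  "quantize_real \<delta> b x =
     (if \<delta> = 0 then return_pmf 0
      else if \<exists>z. z \<in> quant_dom \<delta> b \<and> z + \<delta> \<in> quant_dom \<delta> b \<and> x \<in> {z..z + \<delta>} then
        (let z = (SOME z. z \<in> quant_dom \<delta> b \<and> z + \<delta> \<in> quant_dom \<delta> b \<and> x \<in> {z..z + \<delta>})
         in map_pmf (\<lambda>up. if up then z + \<delta> else z) (bernoulli_pmf ((x - z) / \<delta>)))
      else return_pmf (arg_min_on (\<lambda>y. \<bar>y - x\<bar>) (quant_dom \<delta> b)))"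

definition quantize :: "real \<Rightarrow> nat \<Rightarrow> real ^ 'd \<Rightarrow> (real ^ 'd) pmf" where
  "quantize \<delta> b x = map_pmf vec_lambda (Pi_pmf UNIV 0 (\<lambda>i. quantize_real \<delta> b (x $ i)))"

text \<open>\<open>infnorm\<close> is the max norm.\<close>

definition quantize_scaled :: "nat \<Rightarrow> real ^ 'd \<Rightarrow> (real ^ 'd) pmf" where
  "quantize_scaled b x = quantize (infnorm x / (2 ^ (b - 1) - 1)) b x"

definition quantize_model :: "nat \<Rightarrow> real ^ 'd \<Rightarrow> real ^ 'd \<Rightarrow> (real ^ 'd) pmf" where
  "quantize_model bx xt x = (if x = xt then return_pmf xt else quantize_scaled bx x)"

section \<open>The algorithm\<close>

text \<open>
  The index distributions \<open>p s t\<close> and the delayed indices \<open>D s t\<close> belong to inner iteration \<open>t\<close>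
  of epoch \<open>s\<close> (counted from 0). All draws are made by separate monadic binds, so the index draws
  are mutually independent, and fresh quantization noise is used in each step.

  In an inner loop, \<open>xt\<close> is the snapshot and \<open>X j\<close> is the \<open>j\<close>-th iterate; after \<open>t\<close> steps only
  \<open>X 0, \<dots>, X t\<close> are meaningful.
\<close>

definition asylpg_step ::
    "nat \<Rightarrow> (nat \<Rightarrow> real ^ 'd \<Rightarrow> real) \<Rightarrow> (real ^ 'd \<Rightarrow> real) \<Rightarrow> (real ^ 'd) set \<Rightarrow> real \<Rightarrow>
     nat \<Rightarrow> nat \<Rightarrow> nat pmf \<Rightarrow> nat \<Rightarrow> real ^ 'd \<Rightarrow> nat \<Rightarrow>
     (nat \<Rightarrow> real ^ 'd) \<Rightarrow> (nat \<Rightarrow> real ^ 'd) pmf" where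
  "asylpg_step n f h \<Omega> \<eta> b bx p D xt t X =
     do {
       y \<leftarrow> quantize_model bx xt (X D);
       a \<leftarrow> p;
       q \<leftarrow> quantize_scaled b (grad (f a) y - grad (f a) xt);
       let u = q + grad (avg n f) xt;
       return_pmf (X(Suc t := prox \<Omega> \<eta> h (X t - \<eta> *\<^sub>R u)))
     }"

primrec asylpg_inner ::
    "nat \<Rightarrow> (nat \<Rightarrow> real ^ 'd \<Rightarrow> real) \<Rightarrow> (real ^ 'd \<Rightarrow> real) \<Rightarrow> (real ^ 'd) set \<Rightarrow> real \<Rightarrow>
     nat \<Rightarrow> nat \<Rightarrow> (nat \<Rightarrow> nat pmf) \<Rightarrow> (nat \<Rightarrow> nat) \<Rightarrow> real ^ 'd \<Rightarrow> nat \<Rightarrow>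
     (nat \<Rightarrow> real ^ 'd) pmf" where
  "asylpg_inner n f h \<Omega> \<eta> b bx p D xt 0 = return_pmf (\<lambda>_. xt)"
| "asylpg_inner n f h \<Omega> \<eta> b bx p D xt (Suc t) =
     asylpg_inner n f h \<Omega> \<eta> b bx p D xt t \<bind> asylpg_step n f h \<Omega> \<eta> b bx (p t) (D t) xt t"

text \<open>
  The state after \<open>s\<close> epochs consists of the current snapshot and the record \<open>Z\<close> of all
  iterates so far, \<open>Z r t\<close> being the \<open>t\<close>-th iterate of epoch \<open>r < s\<close>.
\<close>

primrec asylpg_epochs ::
    "nat \<Rightarrow> (nat \<Rightarrow> real ^ 'd \<Rightarrow> real) \<Rightarrow> (real ^ 'd \<Rightarrow> real) \<Rightarrow> (real ^ 'd) set \<Rightarrow> real \<Rightarrow>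
     nat \<Rightarrow> nat \<Rightarrow> (nat \<Rightarrow> nat \<Rightarrow> nat pmf) \<Rightarrow> (nat \<Rightarrow> nat \<Rightarrow> nat) \<Rightarrow> nat \<Rightarrow> real ^ 'd \<Rightarrow> nat \<Rightarrow>
     ((real ^ 'd) \<times> (nat \<Rightarrow> nat \<Rightarrow> real ^ 'd)) pmf" where
  "asylpg_epochs n f h \<Omega> \<eta> b bx p D m x0 0 = return_pmf (x0, \<lambda>_ _. x0)"
| "asylpg_epochs n f h \<Omega> \<eta> b bx p D m x0 (Suc s) =
     do {
       (xt, Z) \<leftarrow> asylpg_epochs n f h \<Omega> \<eta> b bx p D m x0 s;
       X \<leftarrow> asylpg_inner n f h \<Omega> \<eta> b bx (p s) (D s) xt m;
       return_pmf (X m, Z(s := X))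
     }"

definition asylpg_output ::
    "nat \<Rightarrow> (nat \<Rightarrow> real ^ 'd \<Rightarrow> real) \<Rightarrow> (real ^ 'd \<Rightarrow> real) \<Rightarrow> (real ^ 'd) set \<Rightarrow> real \<Rightarrow>
     nat \<Rightarrow> nat \<Rightarrow> (nat \<Rightarrow> nat \<Rightarrow> nat pmf) \<Rightarrow> (nat \<Rightarrow> nat \<Rightarrow> nat) \<Rightarrow> nat \<Rightarrow> real ^ 'd \<Rightarrow> nat \<Rightarrow>
     (real ^ 'd) pmf" where
  "asylpg_output n f h \<Omega> \<eta> b bx p D m x0 S =
     do {
       (xt, Z) \<leftarrow> asylpg_epochs n f h \<Omega> \<eta> b bx p D m x0 S;
       (s, t) \<leftarrow> pmf_of_set ({..<S} \<times> {..<m});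
       return_pmf (Z s t)
     }"

text \<open>
  The pairs (snapshot, delayed iterate) that the model quantizer can meet with positive
  probability. All distributions above are discrete, so almost-sure statements about a run
  are statements about all such pairs.
\<close>

definition asylpg_delayed ::
    "nat \<Rightarrow> (nat \<Rightarrow> real ^ 'd \<Rightarrow> real) \<Rightarrow> (real ^ 'd \<Rightarrow> real) \<Rightarrow> (real ^ 'd) set \<Rightarrow> real \<Rightarrow>
     nat \<Rightarrow> nat \<Rightarrow> (nat \<Rightarrow> nat \<Rightarrow> nat pmf) \<Rightarrow> (nat \<Rightarrow> nat \<Rightarrow> nat) \<Rightarrow> nat \<Rightarrow> real ^ 'd \<Rightarrow> nat \<Rightarrow>
     ((real ^ 'd) \<times> (real ^ 'd)) set" where
  "asylpg_delayed n f h \<Omega> \<eta> b bx p D m x0 S =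
     {(xt, X (D s t)) | xt Z X s t.
        s < S \<and> t < m \<and>
        (xt, Z) \<in> set_pmf (asylpg_epochs n f h \<Omega> \<eta> b bx p D m x0 s) \<and>
        X \<in> set_pmf (asylpg_inner n f h \<Omega> \<eta> b bx (p s) (D s) xt t)}"

end

theory Submission
  imports Defs
begin

text \<open>
  Write \<open>w\<close> for the exact prox step from \<open>x\<close> and \<open>x'\<close> for the one along an estimate \<open>u\<close> of the
  gradient. Adding the three-point inequality of the proximal operator for both steps and the
  descent lemma for \<open>f\<close> yields
  \<open>P x' + \<eta>/2 * |G x|^2 + (1/(2\<eta>) - L/2) * |x' - x|^2 \<le> P x + \<eta>/2 * |\<nabla>f x - u|^2\<close>.
  The gradient quantizer is unbiased with variance at most \<open>\<Delta> * |\<alpha>|^2\<close>, so in expectation the last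
  term is controlled by the distances of the delayed iterate from the snapshot and from \<open>x\<close>. Along
  an epoch Cauchy-Schwarz bounds the sum of either squared distance by \<open>m^2\<close> times the sum of the
  squared increments \<open>|x' - x|^2\<close>, and the step size condition lets the increments on the left
  absorb them.
\<close>

subsection \<open>Proximal gradient steps\<close>

text \<open>\<open>grad\<close> is a definite description, so existence and uniqueness are both
  owed. Existence is the Riesz representation in coordinates: the functional \<open>F'\<close> is
  the inner product with the sum of \<open>F' b *\<^sub>R b\<close> over the basis.\<close>

lemma GDERIV_grad:
  fixes F :: "'a::euclidean_space \<Rightarrow> real"
  assumes "F differentiable (at x)"
  shows "GDERIV F x :> grad F x"
proof -
  obtain F' where F': "(F has_derivative F') (at x)"
    using assms by (auto simp: differentiable_def)
  then interpret bounded_linear F' by (rule has_derivative_bounded_linear)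
  have "F' v = inner v (\<Sum>b\<in>Basis. F' b *\<^sub>R b)" for v
  proof -
    have "F' v = F' (\<Sum>b\<in>Basis. inner v b *\<^sub>R b)" by (simp add: euclidean_representation)
    also have "\<dots> = (\<Sum>b\<in>Basis. inner v b * F' b)" by (simp add: sum scaleR)
    finally show ?thesis by (simp add: inner_sum_right mult.commute)
  qed
  then have "F' = (\<lambda>v. inner v (\<Sum>b\<in>Basis. F' b *\<^sub>R b))" by blast
  with F' have ex: "GDERIV F x :> (\<Sum>b\<in>Basis. F' b *\<^sub>R b)"
    by (simp add: gderiv_def)
  have uniq: "g = g'" if "GDERIV F x :> g" "GDERIV F x :> g'" for g g'
    using has_derivative_unique[OF that[unfolded gderiv_def]]
    by (metis vector_eq_ldot)
  show ?thesis
    unfolding grad_def by (rule theI[where P="\<lambda>g. GDERIV F x :> g", OF ex]) (rule uniq[OF _ ex])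
qed

lemma grad_eqI:
  fixes F :: "'a::euclidean_space \<Rightarrow> real"
  assumes "GDERIV F x :> g"
  shows "grad F x = g"
proof -
  have "F differentiable (at x)" using assms by (auto simp: gderiv_def differentiable_def)
  from has_derivative_unique[OF GDERIV_grad[OF this, unfolded gderiv_def] assms[unfolded gderiv_def]]
  show ?thesis by (metis vector_eq_ldot)
qed

lemma GDERIV_avg:
  fixes f :: "nat \<Rightarrow> 'a::euclidean_space \<Rightarrow> real"
  assumes "\<And>i. i \<in> {1..n} \<Longrightarrow> f i differentiable (at x)"
  shows "GDERIV (avg n f) x :> (1 / real n) *\<^sub>R (\<Sum>i = 1..n. grad (f i) x)"
proof -
  have "((\<lambda>x. 1 / real n * (\<Sum>i = 1..n. f i x)) has_derivative
      (\<lambda>v. 1 / real n * (\<Sum>i = 1..n. inner v (grad (f i) x)))) (at x)"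
    by (intro derivative_intros GDERIV_grad[unfolded gderiv_def] assms)
  then show ?thesis
    by (simp add: gderiv_def avg_def[abs_def] inner_sum_right)
qed

lemma grad_avg_lipschitz:
  fixes f :: "nat \<Rightarrow> 'a::euclidean_space \<Rightarrow> real"
  assumes n: "n \<ge> 1"
    and diff: "\<And>i. i \<in> {1..n} \<Longrightarrow> f i differentiable (at x)"
      "\<And>i. i \<in> {1..n} \<Longrightarrow> f i differentiable (at y)"
    and lip: "\<And>i. i \<in> {1..n} \<Longrightarrow> norm (grad (f i) x - grad (f i) y) \<le> C"
  shows "norm (grad (avg n f) x - grad (avg n f) y) \<le> C"
proof -
  have "norm (grad (avg n f) x - grad (avg n f) y)
      = norm (\<Sum>i = 1..n. grad (f i) x - grad (f i) y) / real n"
    using grad_eqI[OF GDERIV_avg[of n f x]] grad_eqI[OF GDERIV_avg[of n f y]] diff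
    by (simp add: sum_subtractf flip: scaleR_diff_right)
  also have "\<dots> \<le> (real n * C) / real n"
  proof (intro divide_right_mono)
    show "norm (\<Sum>i = 1..n. grad (f i) x - grad (f i) y) \<le> real n * C"
      using sum_norm_le[of "{1..n}" "\<lambda>i. grad (f i) x - grad (f i) y" "\<lambda>_. C"] lip by simp
  qed simp
  also have "\<dots> = C" using n by simp
  finally show ?thesis .
qed

text \<open>\<open>\<phi>\<close> is \<open>F\<close> along the segment from \<open>x\<close> to
  \<open>y\<close> minus its linear part and the quadratic bound. Cauchy-Schwarz and the Lipschitz
  condition make its derivative nonpositive, so monotonicity replaces an integral of the gradient.
  Convexity of \<open>\<Omega>\<close> keeps the segment inside \<open>\<Omega>\<close>.\<close>

lemma descent_lemma:
  fixes F :: "'a::euclidean_space \<Rightarrow> real"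
  assumes "convex \<Omega>" and diff: "\<And>x. x \<in> \<Omega> \<Longrightarrow> F differentiable (at x)"
    and lip: "\<And>x y. x \<in> \<Omega> \<Longrightarrow> y \<in> \<Omega> \<Longrightarrow> norm (grad F x - grad F y) \<le> L * norm (x - y)"
    and x: "x \<in> \<Omega>" and y: "y \<in> \<Omega>"
  shows "F y \<le> F x + inner (grad F x) (y - x) + L / 2 * (norm (y - x))\<^sup>2"
proof -
  define d where "d = y - x"
  define \<phi> where "\<phi> t = F (x + t *\<^sub>R d) - t * inner (grad F x) d - L / 2 * t\<^sup>2 * (norm d)\<^sup>2" for t
  have mem: "x + t *\<^sub>R d \<in> \<Omega>" if "0 \<le> t" "t \<le> 1" for t
    using convexD_alt[OF \<open>convex \<Omega>\<close> x y that]
    by (simp add: d_def algebra_simps)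
  have "\<phi> 1 \<le> \<phi> 0"
  proof (rule DERIV_nonpos_imp_nonincreasing[of 0 1 \<phi>])
    fix t :: real assume t: "0 \<le> t" "t \<le> 1"
    have "((\<lambda>t. F (x + t *\<^sub>R d)) has_derivative (\<lambda>s. inner (s *\<^sub>R d) (grad F (x + t *\<^sub>R d)))) (at t)"
      by (rule has_derivative_compose[where f="\<lambda>t. x + t *\<^sub>R d",
            OF _ GDERIV_grad[OF diff[OF mem[OF t]], unfolded gderiv_def]])
        (auto intro!: derivative_eq_intros)
    then have "DERIV (\<lambda>t. F (x + t *\<^sub>R d)) t :> inner d (grad F (x + t *\<^sub>R d))"
      by (simp add: has_field_derivative_def mult_commute_abs)
    then have "DERIV \<phi> t :> inner d (grad F (x + t *\<^sub>R d)) - inner (grad F x) d - L * t * (norm d)\<^sup>2"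
      unfolding \<phi>_def by (auto intro!: derivative_eq_intros)
    moreover have "inner d (grad F (x + t *\<^sub>R d)) - inner (grad F x) d \<le> L * t * (norm d)\<^sup>2"
    proof -
      have "inner d (grad F (x + t *\<^sub>R d)) - inner (grad F x) d
          = inner d (grad F (x + t *\<^sub>R d) - grad F x)"
        by (simp add: inner_diff_right inner_commute)
      also have "\<dots> \<le> norm d * norm (grad F (x + t *\<^sub>R d) - grad F x)"
        by (rule norm_cauchy_schwarz)
      also have "\<dots> \<le> norm d * (L * (t * norm d))"
        using lip[OF mem[OF t] x] t by (intro mult_left_mono) auto
      finally show ?thesis by (simp add: power2_eq_square mult_ac)
    qed
    ultimately show "\<exists>c. DERIV \<phi> t :> c \<and> c \<le> 0" by force
  qed simp
  then show ?thesis by (simp add: \<phi>_def d_def)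
qed

text \<open>\<open>arg_min_on\<close> is a choice that says nothing unless a minimiser exists; hence
  the existence premise, here and in the facts about \<open>prox\<close> that follow.\<close>

lemma prox_in:
  assumes "\<exists>y. is_arg_min (prox_objective \<eta> h x) (\<lambda>y. y \<in> \<Omega>) y"
  shows "prox \<Omega> \<eta> h x \<in> \<Omega>"
  using someI_ex[OF assms]
  by (simp add: prox_def arg_min_on_def arg_min_def is_arg_min_def)

lemma prox_le:
  assumes "\<exists>y. is_arg_min (prox_objective \<eta> h x) (\<lambda>y. y \<in> \<Omega>) y" and "z \<in> \<Omega>"
  shows "prox_objective \<eta> h x (prox \<Omega> \<eta> h x) \<le> prox_objective \<eta> h x z"
  using someI_ex[OF assms(1)] assms(2)
  by (auto simp: prox_def arg_min_on_def arg_min_def is_arg_min_def not_less)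

text \<open>The last term is the exact defect in the convexity of the squared norm. It is the source
  of the quadratic growth in \<open>prox_three_point\<close>.\<close>

lemma norm_convex_combination_sq:
  fixes p z :: "'a::real_inner"
  shows "(norm ((1 - l) *\<^sub>R p + l *\<^sub>R z))\<^sup>2
    = (1 - l) * (norm p)\<^sup>2 + l * (norm z)\<^sup>2 - l * (1 - l) * (norm (z - p))\<^sup>2"
  by (simp add: power2_norm_eq_inner inner_add_left inner_add_right inner_diff_left inner_diff_right
      inner_commute) (simp add: algebra_simps)

text \<open>The prox objective is strongly convex, so it grows quadratically away from its
  minimiser. Comparing the minimiser with points of the segment to \<open>z\<close> shows this
  without subgradients of the possibly nonsmooth \<open>h\<close>.\<close>

lemma prox_three_point:
  fixes h :: "'a::real_inner \<Rightarrow> real"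
  assumes "convex \<Omega>" "convex_on \<Omega> h" "\<eta> > 0"
    and ex: "\<exists>y. is_arg_min (prox_objective \<eta> h x) (\<lambda>y. y \<in> \<Omega>) y" and z: "z \<in> \<Omega>"
  shows "prox_objective \<eta> h x (prox \<Omega> \<eta> h x) + 1 / (2 * \<eta>) * (norm (z - prox \<Omega> \<eta> h x))\<^sup>2
    \<le> prox_objective \<eta> h x z"
proof -
  define q where "q = prox \<Omega> \<eta> h x"
  define c where "c = 1 / (2 * \<eta>)"
  have c: "c > 0" using \<open>\<eta> > 0\<close> by (simp add: c_def)
  have q: "q \<in> \<Omega>" unfolding q_def by (rule prox_in[OF ex])
  let ?\<phi> = "prox_objective \<eta> h x"
  have *: "?\<phi> q + c * (1 - l) * (norm (z - q))\<^sup>2 \<le> ?\<phi> z" if l: "0 < l" "l < 1" for l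
  proof -
    let ?w = "(1 - l) *\<^sub>R q + l *\<^sub>R z"
    have w: "?w \<in> \<Omega>" using convexD_alt[OF \<open>convex \<Omega>\<close> q z] l by simp
    have "?w - x = (1 - l) *\<^sub>R (q - x) + l *\<^sub>R (z - x)" by (simp add: algebra_simps)
    then have n: "(norm (?w - x))\<^sup>2 = (1 - l) * (norm (q - x))\<^sup>2 + l * (norm (z - x))\<^sup>2
        - l * (1 - l) * (norm (z - q))\<^sup>2"
      using norm_convex_combination_sq[of l "q - x" "z - x"] by simp
    have "?\<phi> q \<le> ?\<phi> ?w" unfolding q_def by (rule prox_le[OF ex w[unfolded q_def]])
    also have "\<dots> \<le> (1 - l) * h q + l * h z + c * (norm (?w - x))\<^sup>2"
      using convex_onD[OF \<open>convex_on \<Omega> h\<close>, of l q z] l q z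
      by (simp add: prox_objective_def c_def)
    also have "\<dots> = (1 - l) * ?\<phi> q + l * (?\<phi> z - c * (1 - l) * (norm (z - q))\<^sup>2)"
      unfolding n by (simp only: prox_objective_def flip: c_def) (simp add: algebra_simps)
    finally have "l * (?\<phi> q + c * (1 - l) * (norm (z - q))\<^sup>2) \<le> l * ?\<phi> z"
      by (simp add: algebra_simps)
    then show ?thesis using l by simp
  qed
  \<comment> \<open>Cancelling \<open>l\<close> has left the factor \<open>1 - l\<close>, which
    disappears as \<open>l\<close> tends to 0 from the right.\<close>
  have "?\<phi> q + c * (1 - 0) * (norm (z - q))\<^sup>2 \<le> ?\<phi> z"
  proof (rule tendsto_upperbound)
    show "((\<lambda>l. ?\<phi> q + c * (1 - l) * (norm (z - q))\<^sup>2) \<longlongrightarrow>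
        ?\<phi> q + c * (1 - 0) * (norm (z - q))\<^sup>2) (at_right 0)"
      by (intro tendsto_intros)
    show "\<forall>\<^sub>F l in at_right 0. ?\<phi> q + c * (1 - l) * (norm (z - q))\<^sup>2 \<le> ?\<phi> z"
      unfolding eventually_at_right_field using * by (intro exI[of _ 1]) auto
  qed simp
  then show ?thesis by (simp add: q_def c_def)
qed

lemma prox_step_descent:
  fixes F h :: "'a::euclidean_space \<Rightarrow> real"
  assumes "convex \<Omega>" "convex_on \<Omega> h" "\<eta> > 0"
    and ex: "\<And>x. \<exists>y. is_arg_min (prox_objective \<eta> h x) (\<lambda>y. y \<in> \<Omega>) y"
    and diff: "\<And>x. x \<in> \<Omega> \<Longrightarrow> F differentiable (at x)"
    and lip: "\<And>x y. x \<in> \<Omega> \<Longrightarrow> y \<in> \<Omega> \<Longrightarrow> norm (grad F x - grad F y) \<le> L * norm (x - y)"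
    and x: "x \<in> \<Omega>"
  shows "F (prox \<Omega> \<eta> h (x - \<eta> *\<^sub>R v)) + h (prox \<Omega> \<eta> h (x - \<eta> *\<^sub>R v))
      + \<eta> / 2 * (norm (grad_mapping \<Omega> \<eta> F h x))\<^sup>2
      + (1 / (2 * \<eta>) - L / 2) * (norm (prox \<Omega> \<eta> h (x - \<eta> *\<^sub>R v) - x))\<^sup>2
    \<le> F x + h x + \<eta> / 2 * (norm (grad F x - v))\<^sup>2"
proof -
  define g where "g = grad F x"
  define w where "w = prox \<Omega> \<eta> h (x - \<eta> *\<^sub>R g)"
  define x' where "x' = prox \<Omega> \<eta> h (x - \<eta> *\<^sub>R v)"
  have w: "w \<in> \<Omega>" and x': "x' \<in> \<Omega>" by (simp_all add: w_def x'_def prox_in[OF ex])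
  \<comment> \<open>Completing the square turns the objective into the linearised model at
    \<open>x\<close>. The summand with \<open>norm u\<close> does not depend on \<open>y\<close> and
    cancels when two points are compared.\<close>
  have expand: "prox_objective \<eta> h (x - \<eta> *\<^sub>R u) y
      = h y + inner u (y - x) + 1 / (2 * \<eta>) * (norm (y - x))\<^sup>2 + \<eta> / 2 * (norm u)\<^sup>2" for u y
  proof -
    have "(norm (y - (x - \<eta> *\<^sub>R u)))\<^sup>2 = (norm ((y - x) + \<eta> *\<^sub>R u))\<^sup>2" by (simp add: algebra_simps)
    also have "\<dots> = (norm (y - x))\<^sup>2 + 2 * \<eta> * inner u (y - x) + \<eta>\<^sup>2 * (norm u)\<^sup>2"
      by (simp only: power2_norm_eq_inner inner_add_left inner_add_right)
        (simp add: inner_commute power2_eq_square)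
    finally show ?thesis using \<open>\<eta> > 0\<close>
      by (simp add: prox_objective_def field_simps power2_eq_square)
  qed
  note tp = prox_three_point[OF assms(1-3) ex]
  \<comment> \<open>The exact step \<open>w\<close> is tested against \<open>x\<close>: one
    quadratic term comes from the objective, the other from strong convexity.\<close>
  have A: "h w + inner g (w - x) + 1 / (2 * \<eta>) * (norm (w - x))\<^sup>2
      + 1 / (2 * \<eta>) * (norm (w - x))\<^sup>2 \<le> h x"
    using tp[OF x, of "x - \<eta> *\<^sub>R g", folded w_def, unfolded expand] by (simp add: norm_minus_commute)
  \<comment> \<open>The inexact step \<open>x'\<close> is tested against \<open>w\<close>, which
    makes the terms \<open>h w\<close> cancel when \<open>A\<close> and \<open>B\<close> are
    added.\<close>
  have B: "h x' + inner v (x' - x) + 1 / (2 * \<eta>) * (norm (x' - x))\<^sup>2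
      + 1 / (2 * \<eta>) * (norm (x' - w))\<^sup>2
      \<le> h w + inner v (w - x) + 1 / (2 * \<eta>) * (norm (w - x))\<^sup>2"
    using tp[OF w, of "x - \<eta> *\<^sub>R v", folded x'_def, unfolded expand] by (simp add: norm_minus_commute)
  have C: "F x' \<le> F x + inner g (x' - x) + L / 2 * (norm (x' - x))\<^sup>2"
    unfolding g_def by (rule descent_lemma[OF assms(1) diff lip x x'])
  \<comment> \<open>Young's inequality, with weights chosen so that the \<open>x' - w\<close> term
    is exactly the strong convexity term on the left of \<open>B\<close>.\<close>
  have Y: "inner (g - v) (x' - w) \<le> \<eta> / 2 * (norm (g - v))\<^sup>2 + 1 / (2 * \<eta>) * (norm (x' - w))\<^sup>2"
  proof -
    have "0 \<le> 1 / (2 * \<eta>) * (norm (\<eta> *\<^sub>R (g - v) - (x' - w)))\<^sup>2" using \<open>\<eta> > 0\<close> by simp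
    also have "(norm (\<eta> *\<^sub>R (g - v) - (x' - w)))\<^sup>2
        = \<eta>\<^sup>2 * (norm (g - v))\<^sup>2 - 2 * \<eta> * inner (g - v) (x' - w) + (norm (x' - w))\<^sup>2"
      unfolding power2_norm_eq_inner inner_diff_left[of "\<eta> *\<^sub>R (g - v)"]
        inner_diff_right[of _ "\<eta> *\<^sub>R (g - v)"]
      by (simp add: inner_commute power2_eq_square)
    finally show ?thesis using \<open>\<eta> > 0\<close> by (simp add: field_simps power2_eq_square)
  qed
  have G: "\<eta> / 2 * (norm (grad_mapping \<Omega> \<eta> F h x))\<^sup>2 = 1 / (2 * \<eta>) * (norm (w - x))\<^sup>2"
    using \<open>\<eta> > 0\<close>
    by (simp only: grad_mapping_def norm_scaleR flip: g_def w_def)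
      (simp add: power_mult_distrib norm_minus_commute field_simps power2_eq_square)
  have I: "inner g (x' - x) - inner g (w - x) - inner v (x' - x) + inner v (w - x) = inner (g - v) (x' - w)"
    by (simp add: inner_diff_left inner_diff_right)
  have "F x' + h x' + 1 / (2 * \<eta>) * (norm (w - x))\<^sup>2 + 1 / (2 * \<eta>) * (norm (x' - x))\<^sup>2
      \<le> F x + h x + L / 2 * (norm (x' - x))\<^sup>2 + \<eta> / 2 * (norm (g - v))\<^sup>2"
    using A B C Y I by linarith
  then show ?thesis
    unfolding G x'_def[symmetric] g_def[symmetric] by (simp add: algebra_simps)
qed

subsection \<open>Expectations over finitely supported distributions\<close>

lemma expectation_mono_finite:
  fixes g h :: "'a \<Rightarrow> real"
  assumes "finite (set_pmf q)" "\<And>x. x \<in> set_pmf q \<Longrightarrow> g x \<le> h x"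
  shows "measure_pmf.expectation q g \<le> measure_pmf.expectation q h"
  using assms by (intro integral_mono_AE integrable_measure_pmf_finite) (auto simp: AE_measure_pmf_iff)

lemma expectation_bind_finite:
  fixes h :: "'b \<Rightarrow> real"
  assumes "finite (set_pmf q)" "\<And>x. x \<in> set_pmf q \<Longrightarrow> finite (set_pmf (k x))"
  shows "measure_pmf.expectation (q \<bind> k) h
    = measure_pmf.expectation q (\<lambda>x. measure_pmf.expectation (k x) h)"
  using assms by (simp add: pmf_expectation_bind[of "set_pmf q"] integral_measure_pmf[of "set_pmf q"])

text \<open>The tower property as used for the potential arguments: a bound on the conditional
  expectation given each reachable state passes to the whole run.\<close>

lemma expectation_bind_le:
  fixes h :: "'b \<Rightarrow> real"
  assumes "finite (set_pmf q)" "\<And>x. x \<in> set_pmf q \<Longrightarrow> finite (set_pmf (k x))"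
    and "\<And>x. x \<in> set_pmf q \<Longrightarrow> measure_pmf.expectation (k x) h \<le> g x"
  shows "measure_pmf.expectation (q \<bind> k) h \<le> measure_pmf.expectation q g"
  by (subst expectation_bind_finite[OF assms(1,2)])
    (assumption | rule expectation_mono_finite[OF assms(1,3)])+

text \<open>Bias-variance decomposition with the variance of \<open>A\<close> bounded by its second
  moment. Only the mean of \<open>A\<close> meets the shift \<open>c\<close>.\<close>

lemma expectation_norm_shift_le:
  fixes A :: "'a \<Rightarrow> 'b::euclidean_space"
  assumes "finite (set_pmf q)"
  shows "measure_pmf.expectation q (\<lambda>x. (norm (A x + c))\<^sup>2)
    \<le> (norm (measure_pmf.expectation q A + c))\<^sup>2 + measure_pmf.expectation q (\<lambda>x. (norm (A x))\<^sup>2)"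
proof -
  note [intro!] = integrable_measure_pmf_finite[OF assms]
  have expand: "(norm (v + c))\<^sup>2 = (norm v)\<^sup>2 + 2 * inner v c + (norm c)\<^sup>2" for v :: 'b
    by (simp add: power2_norm_eq_inner inner_add_left inner_add_right inner_commute)
  have "measure_pmf.expectation q (\<lambda>x. (norm (A x + c))\<^sup>2)
      = measure_pmf.expectation q (\<lambda>x. (norm (A x))\<^sup>2) + 2 * inner (measure_pmf.expectation q A) c + (norm c)\<^sup>2"
    unfolding expand using integrable_measure_pmf_finite[OF assms, of A]
    by (simp add: integrable_measure_pmf_finite[OF assms])
  then show ?thesis by (simp add: expand)
qed

subsection \<open>Variance of the quantizer\<close>

lemma quantize_cell_exists:
  assumes "b \<ge> 2" "\<delta> > 0" "\<bar>x\<bar> \<le> (2 ^ (b - 1) - 1) * \<delta>"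
  shows "\<exists>z. z \<in> quant_dom \<delta> b \<and> z + \<delta> \<in> quant_dom \<delta> b \<and> x \<in> {z..z + \<delta>}"
proof -
  define N :: int where "N = 2 ^ (b - 1) - 1"
  have "(2::int) ^ 1 \<le> 2 ^ (b - 1)" using \<open>b \<ge> 2\<close> by (intro power_increasing) auto
  then have N: "N \<ge> 1" by (simp add: N_def)
  have N': "real_of_int N = 2 ^ (b - 1) - 1" by (simp add: N_def)
  have xN: "\<bar>x / \<delta>\<bar> \<le> N" using assms(2,3) unfolding N'[symmetric] by (simp add: abs_divide field_simps)
  \<comment> \<open>The cap at \<open>N - 1\<close> matters only at the right end: for
    \<open>x = N * \<delta>\<close> the floor is \<open>N\<close>, and the cell starting there would
    leave the grid.\<close>
  define k where "k = min \<lfloor>x / \<delta>\<rfloor> (N - 1)"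
  have lo: "- N \<le> \<lfloor>x / \<delta>\<rfloor>" using xN by (simp add: le_floor_iff abs_le_iff del: abs_divide)
  have hi: "x / \<delta> \<le> N" using xN by linarith
  have k: "- N \<le> k" "k \<le> N - 1" using lo N by (auto simp: k_def)
  have "x / \<delta> \<le> of_int k + 1"
  proof (cases "\<lfloor>x / \<delta>\<rfloor> \<le> N - 1")
    case True
    then show ?thesis by (simp add: k_def)
  qed (use hi in \<open>simp add: k_def min_def\<close>)
  moreover have "k \<le> \<lfloor>x / \<delta>\<rfloor>" by (simp add: k_def)
  then have "of_int k \<le> x / \<delta>" by (simp only: le_floor_iff)
  ultimately have "of_int k \<le> x / \<delta>" "x / \<delta> \<le> of_int k + 1" by auto
  then have "of_int k * \<delta> \<le> x" "x \<le> of_int k * \<delta> + \<delta>"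
    using \<open>\<delta> > 0\<close> by (auto simp: field_simps)
  moreover have "of_int k * \<delta> \<in> quant_dom \<delta> b" "of_int (k + 1) * \<delta> \<in> quant_dom \<delta> b"
    unfolding quant_dom_def by (rule imageI, use k in \<open>simp add: N_def\<close>)+
  ultimately show ?thesis by (intro exI[of _ "of_int k * \<delta>"]) (simp add: algebra_simps)
qed

lemma finite_set_quantize_real: "finite (set_pmf (quantize_real \<delta> b x))"
  by (simp add: quantize_real_def Let_def)

lemma finite_set_quantize: "finite (set_pmf (quantize \<delta> b x))"
  unfolding quantize_def
  by (auto simp: set_Pi_pmf intro!: finite_imageI finite_PiE_dflt finite_set_quantize_real)

lemma finite_set_quantize_model: "finite (set_pmf (quantize_model b xt x))"
  by (simp add: quantize_model_def quantize_scaled_def finite_set_quantize)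

text \<open>The second moment about an arbitrary \<open>- c\<close> records unbiasedness and
  variance in one inequality. Rounding up with probability \<open>q\<close> has variance
  \<open>q * (1 - q)\<close> times the square of \<open>\<delta>\<close>, and
  \<open>q * (1 - q)\<close> is at most 1/4.\<close>

lemma expectation_quantize_real_le:
  assumes "b \<ge> 2" "\<delta> \<ge> 0" "\<bar>x\<bar> \<le> (2 ^ (b - 1) - 1) * \<delta>"
  shows "measure_pmf.expectation (quantize_real \<delta> b x) (\<lambda>r. (r + c)\<^sup>2) \<le> (x + c)\<^sup>2 + \<delta>\<^sup>2 / 4"
proof (cases "\<delta> = 0")
  \<comment> \<open>The range hypothesis then forces \<open>x = 0\<close>, which is the value the
    quantizer returns.\<close>
  case True
  then show ?thesis using assms by (simp add: quantize_real_def)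
next
  case False
  then have \<delta>: "\<delta> > 0" using assms by simp
  note ex = quantize_cell_exists[OF assms(1) \<delta> assms(3)]
  define z where "z = (SOME z. z \<in> quant_dom \<delta> b \<and> z + \<delta> \<in> quant_dom \<delta> b \<and> x \<in> {z..z + \<delta>})"
  have z: "z \<le> x" "x \<le> z + \<delta>" using someI_ex[OF ex] by (auto simp: z_def)
  define q where "q = (x - z) / \<delta>"
  have q: "0 \<le> q" "q \<le> 1" using z \<delta> by (auto simp: q_def)
  have x: "x = z + q * \<delta>" using \<delta> by (simp add: q_def)
  have "quantize_real \<delta> b x = map_pmf (\<lambda>up. if up then z + \<delta> else z) (bernoulli_pmf q)"
    using False ex unfolding quantize_real_def Let_def z_def[symmetric] q_def[symmetric] by simp
  then have "measure_pmf.expectation (quantize_real \<delta> b x) (\<lambda>r. (r + c)\<^sup>2)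
      = (z + \<delta> + c)\<^sup>2 * q + (z + c)\<^sup>2 * (1 - q)"
    using q by simp
  also have "\<dots> = (x + c)\<^sup>2 + \<delta>\<^sup>2 / 4 - (\<delta> * (q - 1 / 2))\<^sup>2"
    unfolding x by (simp add: power2_eq_square algebra_simps)
  finally show ?thesis by simp
qed

text \<open>The scaling by \<open>infnorm \<alpha>\<close> puts every coordinate in the range where
  no clipping occurs. By linearity only the marginals enter; the one-dimensional variances add up to
  \<open>\<Delta>\<close> times the squared max norm, which the Euclidean norm dominates.\<close>

lemma expectation_quantize_scaled_le:
  fixes \<alpha> c :: "real ^ 'd"
  assumes "b \<ge> 2" and \<Delta>: "\<Delta> = real CARD('d) / (4 * (2 ^ (b - 1) - 1)\<^sup>2)"
  shows "measure_pmf.expectation (quantize_scaled b \<alpha>) (\<lambda>q. (norm (q + c))\<^sup>2)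
    \<le> (norm (\<alpha> + c))\<^sup>2 + \<Delta> * (norm \<alpha>)\<^sup>2"
proof -
  define N :: real where "N = 2 ^ (b - 1) - 1"
  have "(2::real) ^ 1 \<le> 2 ^ (b - 1)" using \<open>b \<ge> 2\<close> by (intro power_increasing) auto
  then have N: "N \<ge> 1" by (simp add: N_def)
  define \<delta> where "\<delta> = infnorm \<alpha> / N"
  have \<delta>: "\<delta> \<ge> 0" using N by (simp add: \<delta>_def infnorm_pos_le)
  have inf: "infnorm \<alpha> = (2 ^ (b - 1) - 1) * \<delta>" using N unfolding N_def[symmetric] by (simp add: \<delta>_def)
  let ?Pi = "Pi_pmf UNIV 0 (\<lambda>i. quantize_real \<delta> b (\<alpha> $ i))"
  have fin: "finite (set_pmf ?Pi)"
    by (auto simp: set_Pi_pmf intro!: finite_PiE_dflt finite_set_quantize_real)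
  have norm_sum: "(norm v)\<^sup>2 = (\<Sum>i\<in>UNIV. (v $ i)\<^sup>2)" for v :: "real ^ 'd"
    by (simp add: norm_vec_def L2_set_def sum_nonneg)
  have "measure_pmf.expectation (quantize_scaled b \<alpha>) (\<lambda>q. (norm (q + c))\<^sup>2)
      = measure_pmf.expectation ?Pi (\<lambda>\<omega>. \<Sum>i\<in>UNIV. (\<omega> i + c $ i)\<^sup>2)"
    unfolding quantize_scaled_def N_def[symmetric] \<delta>_def[symmetric]
    by (simp add: quantize_def norm_sum)
  also have "\<dots> = (\<Sum>i\<in>UNIV. measure_pmf.expectation ?Pi (\<lambda>\<omega>. (\<omega> i + c $ i)\<^sup>2))"
    by (intro Bochner_Integration.integral_sum integrable_measure_pmf_finite fin)
  also have "\<dots> = (\<Sum>i\<in>UNIV. measure_pmf.expectation (map_pmf (\<lambda>\<omega>. \<omega> i) ?Pi) (\<lambda>r. (r + c $ i)\<^sup>2))"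
    by simp
  also have "\<dots> = (\<Sum>i\<in>UNIV. measure_pmf.expectation (quantize_real \<delta> b (\<alpha> $ i)) (\<lambda>r. (r + c $ i)\<^sup>2))"
    by (simp only: Pi_pmf_component finite UNIV_I if_True)
  also have "\<dots> \<le> (\<Sum>i\<in>UNIV. (\<alpha> $ i + c $ i)\<^sup>2 + \<delta>\<^sup>2 / 4)"
    by (intro sum_mono expectation_quantize_real_le assms \<delta>)
      (simp only: inf[symmetric] component_le_infnorm_cart)
  also have "\<dots> = (norm (\<alpha> + c))\<^sup>2 + \<Delta> * (infnorm \<alpha>)\<^sup>2"
    using N unfolding \<Delta> N_def[symmetric] by (simp add: sum.distrib norm_sum \<delta>_def power_divide)
  also have "\<dots> \<le> (norm (\<alpha> + c))\<^sup>2 + \<Delta> * (norm \<alpha>)\<^sup>2"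
    by (intro add_left_mono mult_left_mono power_mono infnorm_le_norm) (auto simp: \<Delta> infnorm_pos_le)
  finally show ?thesis .
qed


subsection \<open>Variance of the gradient estimator\<close>

text \<open>The random part of \<open>asylpg_step\<close>. It sees the history only through the
  delayed iterate \<open>x\<close>; the prox update is then a deterministic map of its
  outcome.\<close>

definition asylpg_direction ::
    "nat \<Rightarrow> (nat \<Rightarrow> real ^ 'd \<Rightarrow> real) \<Rightarrow> nat \<Rightarrow> nat \<Rightarrow> nat pmf \<Rightarrow> real ^ 'd \<Rightarrow> real ^ 'd \<Rightarrow>
     (real ^ 'd) pmf" where
  "asylpg_direction n f b bx p xt x =
     do {
       y \<leftarrow> quantize_model bx xt x;
       a \<leftarrow> p;
       q \<leftarrow> quantize_scaled b (grad (f a) y - grad (f a) xt);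
       return_pmf (q + grad (avg n f) xt)
     }"

lemma asylpg_step_eq_map_direction:
  "asylpg_step n f h \<Omega> \<eta> b bx p D xt t X
    = map_pmf (\<lambda>u. X(Suc t := prox \<Omega> \<eta> h (X t - \<eta> *\<^sub>R u))) (asylpg_direction n f b bx p xt (X D))"
  by (simp add: asylpg_step_def asylpg_direction_def map_bind_pmf Let_def)

lemma finite_set_asylpg_direction:
  "finite (set_pmf p) \<Longrightarrow> finite (set_pmf (asylpg_direction n f b bx p xt x))"
  by (simp add: asylpg_direction_def finite_set_quantize_model quantize_scaled_def finite_set_quantize)

lemma finite_set_asylpg_inner:
  "(\<And>i. i < t \<Longrightarrow> finite (set_pmf (p i)))
    \<Longrightarrow> finite (set_pmf (asylpg_inner n f h \<Omega> \<eta> b bx p D xt t))"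
  by (induction t) (auto simp: asylpg_step_eq_map_direction intro!: finite_set_asylpg_direction)

lemma finite_set_asylpg_epochs:
  "(\<And>r i. r < s \<Longrightarrow> i < m \<Longrightarrow> finite (set_pmf (p r i)))
    \<Longrightarrow> finite (set_pmf (asylpg_epochs n f h \<Omega> \<eta> b bx p D m x0 s))"
proof (induction s)
  case (Suc s)
  have "finite (set_pmf (asylpg_inner n f h \<Omega> \<eta> b bx (p s) (D s) xt m))" for xt
    by (rule finite_set_asylpg_inner) (simp add: Suc.prems)
  then show ?case using Suc by auto
qed simp

lemma norm_diff_sq_le: "(norm (x - z))\<^sup>2 \<le> 2 * (norm (x - y))\<^sup>2 + 2 * (norm (y - z))\<^sup>2"
  for x y z :: "'a::real_normed_vector"
proof -
  have "norm (x - z) \<le> norm (x - y) + norm (y - z)"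
    using norm_triangle_ineq[of "x - y" "y - z"] by simp
  then have "(norm (x - z))\<^sup>2 \<le> (norm (x - y) + norm (y - z))\<^sup>2" by (rule power_mono) simp
  also have "\<dots> \<le> 2 * (norm (x - y))\<^sup>2 + 2 * (norm (y - z))\<^sup>2"
    using sum_squares_bound[of "norm (x - y)" "norm (y - z)"]
    by (simp add: power2_sum)
  finally show ?thesis .
qed

text \<open>Only the deterministic hypotheses are fixed. Those on sampling, quantization and delay
  stay in the lemmas, so that they can be instantiated epoch by epoch.\<close>

locale composite_problem =
  fixes n :: nat and f :: "nat \<Rightarrow> real ^ 'd \<Rightarrow> real" and h :: "real ^ 'd \<Rightarrow> real"
    and \<Omega> :: "(real ^ 'd) set" and L \<eta> :: real
  assumes n_pos: "n \<ge> 1" and L_pos: "L > 0" and \<eta>_pos: "\<eta> > 0"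
    and domain: "convex \<Omega>" and h_convex: "convex_on \<Omega> h"
    and prox_exists: "\<And>x. \<exists>y. is_arg_min (prox_objective \<eta> h x) (\<lambda>y. y \<in> \<Omega>) y"
    and f_differentiable: "\<And>i x. i \<in> {1..n} \<Longrightarrow> x \<in> \<Omega> \<Longrightarrow> f i differentiable (at x)"
    and f_smooth: "\<And>i x y. i \<in> {1..n} \<Longrightarrow> x \<in> \<Omega> \<Longrightarrow> y \<in> \<Omega> \<Longrightarrow>
      norm (grad (f i) x - grad (f i) y) \<le> L * norm (x - y)"
begin

abbreviation "F \<equiv> avg n f"
abbreviation "obj x \<equiv> F x + h x"
abbreviation "G \<equiv> grad_mapping \<Omega> \<eta> F h"

lemma F_differentiable: "x \<in> \<Omega> \<Longrightarrow> F differentiable (at x)"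
  using GDERIV_avg[of n f x] f_differentiable by (auto simp: gderiv_def differentiable_def)

lemma F_smooth: "x \<in> \<Omega> \<Longrightarrow> y \<in> \<Omega> \<Longrightarrow> norm (grad F x - grad F y) \<le> L * norm (x - y)"
  by (rule grad_avg_lipschitz[OF n_pos]) (auto intro: f_differentiable f_smooth)

text \<open>Given the quantized point \<open>y\<close>, gradient quantization costs
  \<open>\<Delta>\<close> and sampling costs 1 times the second moment of \<open>\<alpha> y\<close>,
  and the bias is the gradient difference between \<open>y\<close> and \<open>x\<close>. Smoothness
  turns all of this into distances from \<open>y\<close>, which are then split at the delayed
  iterate \<open>xd\<close>.\<close>

lemma asylpg_direction_variance:
  assumes b: "b \<ge> 2" and \<Delta>: "\<Delta> = real CARD('d) / (4 * (2 ^ (b - 1) - 1)\<^sup>2)"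
    and sampling: "set_pmf p \<subseteq> {1..n}"
    and unbiased: "\<And>y. y \<in> \<Omega> \<Longrightarrow> measure_pmf.expectation p (\<lambda>a. grad (f a) y) = grad F y"
    and mem: "xt \<in> \<Omega>" "x \<in> \<Omega>"
    and quant_domain: "set_pmf (quantize_model bx xt xd) \<subseteq> \<Omega>"
    and quant_error: "measure_pmf.expectation (quantize_model bx xt xd) (\<lambda>y. (norm (y - xd))\<^sup>2)
      \<le> \<mu> * (norm (xd - xt))\<^sup>2"
  shows "measure_pmf.expectation (asylpg_direction n f b bx p xt xd) (\<lambda>u. (norm (grad F x - u))\<^sup>2)
    \<le> 2 * L\<^sup>2 * ((\<mu> + 1) * (\<Delta> + 2) * (norm (xd - xt))\<^sup>2 + (norm (xd - x))\<^sup>2)"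
proof -
  define g where "g = grad F x"
  define gt where "gt = grad F xt"
  define \<alpha> where "\<alpha> y a = grad (f a) y - grad (f a) xt" for y a
  have finp: "finite (set_pmf p)" using sampling finite_subset by blast
  note intp = integrable_measure_pmf_finite[OF finp]
  let ?Q = "quantize_model bx xt xd"
  note intQ = integrable_measure_pmf_finite[OF finite_set_quantize_model[of bx xt xd]]
  have \<Delta>0: "\<Delta> \<ge> 0" by (simp add: \<Delta>)
  have sq: "(norm (grad H y - grad H z))\<^sup>2 \<le> L\<^sup>2 * (norm (y - z))\<^sup>2"
    if "norm (grad H y - grad H z) \<le> L * norm (y - z)" for H :: "real ^ 'd \<Rightarrow> real" and y z
    using power_mono[OF that, of 2] by (simp add: power_mult_distrib)
  let ?inner = "\<lambda>y. p \<bind> (\<lambda>a. quantize_scaled b (\<alpha> y a) \<bind> (\<lambda>q. return_pmf (q + gt)))"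
  have inner: "measure_pmf.expectation (?inner y) (\<lambda>u. (norm (g - u))\<^sup>2)
      \<le> 2 * L\<^sup>2 * (\<Delta> + 2) * (norm (y - xd))\<^sup>2
        + 2 * L\<^sup>2 * ((\<Delta> + 1) * (norm (xd - xt))\<^sup>2 + (norm (xd - x))\<^sup>2)"
    if "y \<in> set_pmf ?Q" for y
  proof -
    have y: "y \<in> \<Omega>" using that quant_domain by blast
    have "measure_pmf.expectation (?inner y) (\<lambda>u. (norm (g - u))\<^sup>2)
        \<le> measure_pmf.expectation p (\<lambda>a. (norm (\<alpha> y a + (gt - g)))\<^sup>2 + \<Delta> * (norm (\<alpha> y a))\<^sup>2)"
    proof (rule expectation_bind_le[OF finp])
      fix a
      have "measure_pmf.expectation (quantize_scaled b (\<alpha> y a) \<bind> (\<lambda>q. return_pmf (q + gt)))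
            (\<lambda>u. (norm (g - u))\<^sup>2)
          = measure_pmf.expectation (quantize_scaled b (\<alpha> y a)) (\<lambda>q. (norm (q + (gt - g)))\<^sup>2)"
        by (simp add: norm_minus_commute[of g] algebra_simps flip: map_pmf_def)
      then show "measure_pmf.expectation (quantize_scaled b (\<alpha> y a) \<bind> (\<lambda>q. return_pmf (q + gt)))
          (\<lambda>u. (norm (g - u))\<^sup>2) \<le> (norm (\<alpha> y a + (gt - g)))\<^sup>2 + \<Delta> * (norm (\<alpha> y a))\<^sup>2"
        using expectation_quantize_scaled_le[OF b \<Delta>, of "\<alpha> y a" "gt - g"] by simp
    qed (simp add: quantize_scaled_def finite_set_quantize)
    also have "\<dots> = measure_pmf.expectation p (\<lambda>a. (norm (\<alpha> y a + (gt - g)))\<^sup>2)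
        + \<Delta> * measure_pmf.expectation p (\<lambda>a. (norm (\<alpha> y a))\<^sup>2)"
      by (simp add: intp)
    also have "\<dots> \<le> (norm (measure_pmf.expectation p (\<alpha> y) + (gt - g)))\<^sup>2
        + (\<Delta> + 1) * measure_pmf.expectation p (\<lambda>a. (norm (\<alpha> y a))\<^sup>2)"
      using expectation_norm_shift_le[OF finp, of "\<alpha> y" "gt - g"] by (simp add: algebra_simps)
    \<comment> \<open>Unbiasedness is applied at \<open>y\<close> and at \<open>xt\<close>; the
      snapshot gradient \<open>gt\<close> then cancels.\<close>
    also have "measure_pmf.expectation p (\<alpha> y) + (gt - g) = grad F y - grad F x"
      using unbiased[OF y] unbiased[OF mem(1)]
      by (simp add: \<alpha>_def[abs_def] intp g_def gt_def)
    also have "(norm (grad F y - grad F x))\<^sup>2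
          + (\<Delta> + 1) * measure_pmf.expectation p (\<lambda>a. (norm (\<alpha> y a))\<^sup>2)
        \<le> L\<^sup>2 * (norm (y - x))\<^sup>2
          + (\<Delta> + 1) * measure_pmf.expectation p (\<lambda>a. L\<^sup>2 * (norm (y - xt))\<^sup>2)"
      unfolding \<alpha>_def using \<Delta>0 sampling
      by (intro add_mono mult_left_mono expectation_mono_finite finp sq F_smooth f_smooth y mem) auto
    also have "\<dots> = L\<^sup>2 * ((norm (y - x))\<^sup>2 + (\<Delta> + 1) * (norm (y - xt))\<^sup>2)"
      by (simp add: algebra_simps)
    also have "\<dots> \<le> L\<^sup>2 * ((2 * (norm (y - xd))\<^sup>2 + 2 * (norm (xd - x))\<^sup>2)
        + (\<Delta> + 1) * (2 * (norm (y - xd))\<^sup>2 + 2 * (norm (xd - xt))\<^sup>2))"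
      using \<Delta>0 by (intro mult_left_mono add_mono norm_diff_sq_le) auto
    finally show ?thesis by (simp add: algebra_simps)
  qed
  have "measure_pmf.expectation (asylpg_direction n f b bx p xt xd) (\<lambda>u. (norm (g - u))\<^sup>2)
      \<le> measure_pmf.expectation ?Q (\<lambda>y. 2 * L\<^sup>2 * (\<Delta> + 2) * (norm (y - xd))\<^sup>2
        + 2 * L\<^sup>2 * ((\<Delta> + 1) * (norm (xd - xt))\<^sup>2 + (norm (xd - x))\<^sup>2))"
    unfolding asylpg_direction_def \<alpha>_def[symmetric] gt_def[symmetric]
    by (intro expectation_bind_le finite_set_quantize_model inner)
      (auto simp: finp quantize_scaled_def finite_set_quantize)
  also have "\<dots> = 2 * L\<^sup>2 * (\<Delta> + 2) * measure_pmf.expectation ?Q (\<lambda>y. (norm (y - xd))\<^sup>2)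
        + 2 * L\<^sup>2 * ((\<Delta> + 1) * (norm (xd - xt))\<^sup>2 + (norm (xd - x))\<^sup>2)"
    by (simp add: intQ)
  \<comment> \<open>Raising \<open>\<Delta> + 1\<close> to \<open>\<Delta> + 2\<close> lets the two
    coefficients of the snapshot distance merge into
    \<open>(\<mu> + 1) * (\<Delta> + 2)\<close>.\<close>
  also have "\<dots> \<le> 2 * L\<^sup>2 * (\<Delta> + 2) * (\<mu> * (norm (xd - xt))\<^sup>2)
        + 2 * L\<^sup>2 * ((\<Delta> + 2) * (norm (xd - xt))\<^sup>2 + (norm (xd - x))\<^sup>2)"
    using \<Delta>0 by (intro add_mono mult_left_mono quant_error mult_right_mono) auto
  finally show ?thesis by (simp add: g_def algebra_simps)
qed

text \<open>Indices beyond \<open>t\<close> are covered too: the loop starts from the constant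
  sequence \<open>xt\<close>, and each step overwrites one positive index by a prox value.\<close>

lemma asylpg_inner_mem:
  assumes "xt \<in> \<Omega>" "X \<in> set_pmf (asylpg_inner n f h \<Omega> \<eta> b bx p D xt t)"
  shows "X j \<in> \<Omega>" and "X 0 = xt"
proof -
  have "(\<forall>j. X j \<in> \<Omega>) \<and> X 0 = xt"
    using assms(2)
    by (induction t arbitrary: X)
      (auto simp: asylpg_step_eq_map_direction assms(1) prox_in[OF prox_exists])
  then show "X j \<in> \<Omega>" "X 0 = xt" by auto
qed

end

subsection \<open>Descent over one epoch\<close>

text \<open>Telescoping and Cauchy-Schwarz. Using the whole epoch length \<open>m\<close> makes the
  bound uniform, so it serves the distance from the snapshot (\<open>i = 0\<close>) as well as the
  effect of the delay.\<close>

lemma norm_path_diff_sq_le: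
  fixes X :: "nat \<Rightarrow> 'a::real_normed_vector"
  assumes "i \<le> j" "j \<le> m"
  shows "(norm (X i - X j))\<^sup>2 \<le> real m * (\<Sum>k<m. (norm (X (Suc k) - X k))\<^sup>2)"
proof -
  have "norm (X i - X j) = norm (\<Sum>k = i..<j. X (Suc k) - X k)"
    using sum_Suc_diff'[OF \<open>i \<le> j\<close>, of X] by (simp add: norm_minus_commute)
  also have "\<dots> \<le> (\<Sum>k = i..<j. norm (X (Suc k) - X k))" by (rule norm_sum)
  also have "\<dots> \<le> (\<Sum>k<m. norm (X (Suc k) - X k))"
    using assms by (intro sum_mono2) auto
  finally have "(norm (X i - X j))\<^sup>2 \<le> (\<Sum>k<m. norm (X (Suc k) - X k))\<^sup>2"
    by (rule power_mono) simp
  also have "\<dots> \<le> real m * (\<Sum>k<m. (norm (X (Suc k) - X k))\<^sup>2)"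
    using sum_squared_le_sum_of_squares[of "\<lambda>k. norm (X (Suc k) - X k)" "{..<m}"]
    by (simp add: mult.commute)
  finally show ?thesis .
qed

context composite_problem begin

text \<open>The objective plus the accumulated \<open>w\<close> does not increase in expectation
  from one step to the next. The errors \<open>e\<close> involve increments of earlier steps, so
  they are absorbed only at the end of the epoch, where the bound holds on every path.\<close>

lemma asylpg_epoch_descent:
  fixes b bx m :: nat and p :: "nat \<Rightarrow> nat pmf" and D :: "nat \<Rightarrow> nat" and xt :: "real ^ 'd"
    and \<mu> \<Delta> :: real
  defines "K \<equiv> (\<mu> + 1) * (\<Delta> + 2)"
    and "I \<equiv> asylpg_inner n f h \<Omega> \<eta> b bx p D xt"
  assumes b: "b \<ge> 2" and \<Delta>: "\<Delta> = real CARD('d) / (4 * (2 ^ (b - 1) - 1)\<^sup>2)" and \<mu>: "\<mu> \<ge> 0"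
    and sampling: "\<And>t. t < m \<Longrightarrow> set_pmf (p t) \<subseteq> {1..n}"
    and unbiased: "\<And>t y. t < m \<Longrightarrow> y \<in> \<Omega> \<Longrightarrow>
      measure_pmf.expectation (p t) (\<lambda>a. grad (f a) y) = grad F y"
    and delay: "\<And>t. t < m \<Longrightarrow> D t \<le> t"
    and xt: "xt \<in> \<Omega>"
    and quant_domain: "\<And>t X. t < m \<Longrightarrow> X \<in> set_pmf (I t) \<Longrightarrow>
      set_pmf (quantize_model bx xt (X (D t))) \<subseteq> \<Omega>"
    and quant_error: "\<And>t X. t < m \<Longrightarrow> X \<in> set_pmf (I t) \<Longrightarrow>
      measure_pmf.expectation (quantize_model bx xt (X (D t))) (\<lambda>y. (norm (y - X (D t)))\<^sup>2)
        \<le> \<mu> * (norm (X (D t) - xt))\<^sup>2"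
    and parameters: "2 * (\<eta> * L)\<^sup>2 * (real m)\<^sup>2 * (K + 1) + \<eta> * L \<le> 1"
  shows "measure_pmf.expectation (I m) (\<lambda>X. obj (X m) + \<eta> / 2 * (\<Sum>i<m. (norm (G (X i)))\<^sup>2)) \<le> obj xt"
proof -
  define \<kappa> where "\<kappa> = 1 / (2 * \<eta>) - L / 2"
  \<comment> \<open>This is \<open>\<eta> / 2\<close> times the bound of
    \<open>asylpg_direction_variance\<close>.\<close>
  define e where "e X i = \<eta> * L\<^sup>2 * (K * (norm (X (D i) - xt))\<^sup>2 + (norm (X (D i) - X i))\<^sup>2)"
    for X :: "nat \<Rightarrow> real ^ 'd" and i
  define w where "w X i = \<eta> / 2 * (norm (G (X i)))\<^sup>2 + \<kappa> * (norm (X (Suc i) - X i))\<^sup>2 - e X i"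
    for X i
  have finp: "finite (set_pmf (p t))" if "t < m" for t
    using sampling[OF that] finite_subset by blast
  have finI: "finite (set_pmf (I t))" if "t \<le> m" for t
    unfolding I_def by (rule finite_set_asylpg_inner) (use that finp in auto)
  have step: "measure_pmf.expectation (asylpg_step n f h \<Omega> \<eta> b bx (p t) (D t) xt t X)
        (\<lambda>X. obj (X (Suc t)) + (\<Sum>i<Suc t. w X i)) \<le> obj (X t) + (\<Sum>i<t. w X i)"
    if t: "t < m" and X: "X \<in> set_pmf (I t)" for t X
  proof -
    define U where "U = asylpg_direction n f b bx (p t) xt (X (D t))"
    define upd where "upd u = X(Suc t := prox \<Omega> \<eta> h (X t - \<eta> *\<^sub>R u))" for u
    \<comment> \<open>The part of the new potential that the history fixes, without the gradient
      mapping and increment terms of step \<open>t\<close>. The summand \<open>- e X t\<close> will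
      cancel the variance.\<close>
    define C where "C = obj (X t) + (\<Sum>i<t. w X i) - e X t"
    have finU: "finite (set_pmf U)" unfolding U_def by (rule finite_set_asylpg_direction[OF finp[OF t]])
    have memX: "X j \<in> \<Omega>" for j using asylpg_inner_mem(1)[OF xt X[unfolded I_def]] .
    have D: "D i \<le> i" if "i \<le> t" for i using delay[of i] that t by simp
    \<comment> \<open>Since \<open>D i \<le> i\<close>, the error at \<open>i \<le> t\<close> reads
      no index beyond \<open>t\<close>, and the update changes only \<open>Suc t\<close>.\<close>
    have e_upd: "e (upd u) i = e X i" if "i \<le> t" for u i
      using D[OF that] that by (simp add: e_def upd_def)
    have w_upd: "w (upd u) i = w X i" if "i < t" for u i
      using e_upd[of i u] that by (simp add: w_def upd_def)
    have bound: "obj (upd u (Suc t)) + (\<Sum>i<Suc t. w (upd u) i) \<le> C + \<eta> / 2 * (norm (grad F (X t) - u))\<^sup>2" for u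
    proof -
      have "(\<Sum>i<Suc t. w (upd u) i) = (\<Sum>i<t. w X i) + w (upd u) t" by (simp add: w_upd)
      moreover have "w (upd u) t = \<eta> / 2 * (norm (G (X t)))\<^sup>2
          + \<kappa> * (norm (prox \<Omega> \<eta> h (X t - \<eta> *\<^sub>R u) - X t))\<^sup>2 - e X t"
        unfolding w_def e_upd[OF order_refl] by (simp add: upd_def)
      ultimately show ?thesis
        using prox_step_descent[OF domain h_convex \<eta>_pos prox_exists F_differentiable F_smooth memX, of t u]
        by (simp add: C_def upd_def \<kappa>_def)
    qed
    have "measure_pmf.expectation (asylpg_step n f h \<Omega> \<eta> b bx (p t) (D t) xt t X)
        (\<lambda>X. obj (X (Suc t)) + (\<Sum>i<Suc t. w X i))
      = measure_pmf.expectation U (\<lambda>u. obj (upd u (Suc t)) + (\<Sum>i<Suc t. w (upd u) i))"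
      unfolding asylpg_step_eq_map_direction U_def upd_def by simp
    also have "\<dots> \<le> measure_pmf.expectation U (\<lambda>u. C + \<eta> / 2 * (norm (grad F (X t) - u))\<^sup>2)"
      by (intro expectation_mono_finite finU bound)
    also have "\<dots> = C + \<eta> / 2 * measure_pmf.expectation U (\<lambda>u. (norm (grad F (X t) - u))\<^sup>2)"
      by (simp add: integrable_measure_pmf_finite[OF finU])
    also have "\<dots> \<le> C + \<eta> / 2 * (2 * L\<^sup>2 * (K * (norm (X (D t) - xt))\<^sup>2 + (norm (X (D t) - X t))\<^sup>2))"
      unfolding U_def K_def using \<eta>_pos
      by (intro add_left_mono mult_left_mono asylpg_direction_variance b \<Delta> sampling unbiased
          quant_domain quant_error t X xt memX) auto
    also have "\<dots> = obj (X t) + (\<Sum>i<t. w X i)" by (simp add: C_def e_def)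
    finally show ?thesis .
  qed
  have potential: "measure_pmf.expectation (I t) (\<lambda>X. obj (X t) + (\<Sum>i<t. w X i)) \<le> obj xt" if "t \<le> m" for t
    using that
  proof (induction t)
    case 0
    then show ?case by (simp add: I_def)
  next
    case (Suc t)
    then have t: "t < m" by simp
    have fin: "finite (set_pmf (asylpg_step n f h \<Omega> \<eta> b bx (p t) (D t) xt t X))" for X
      by (simp add: asylpg_step_eq_map_direction finite_set_asylpg_direction[OF finp[OF t]])
    have I_Suc: "I (Suc t) = I t \<bind> asylpg_step n f h \<Omega> \<eta> b bx (p t) (D t) xt t"
      by (simp add: I_def)
    have "measure_pmf.expectation (I (Suc t)) (\<lambda>X. obj (X (Suc t)) + (\<Sum>i<Suc t. w X i))
        \<le> measure_pmf.expectation (I t) (\<lambda>X. obj (X t) + (\<Sum>i<t. w X i))"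
      unfolding I_Suc by (rule expectation_bind_le[OF finI fin step]) (use t in auto)
    then show ?case using Suc by simp
  qed
  have w_sum: "\<eta> / 2 * (\<Sum>i<m. (norm (G (X i)))\<^sup>2) \<le> (\<Sum>i<m. w X i)" if X: "X \<in> set_pmf (I m)" for X
  proof -
    define A where "A = (\<Sum>k<m. (norm (X (Suc k) - X k))\<^sup>2)"
    have A: "A \<ge> 0" by (simp add: A_def sum_nonneg)
    have X0: "X 0 = xt" using asylpg_inner_mem(2)[OF xt X[unfolded I_def]] .
    have K: "K \<ge> 0" using \<mu> by (simp add: K_def \<Delta>)
    have "(\<Sum>i<m. e X i) \<le> (\<Sum>i<m. \<eta> * L\<^sup>2 * (K * (real m * A) + real m * A))"
    proof (rule sum_mono)
      fix i assume "i \<in> {..<m}"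
      then have i: "D i \<le> i" "i \<le> m" using delay by auto
      have "(norm (X (D i) - xt))\<^sup>2 \<le> real m * A"
        using norm_path_diff_sq_le[of 0 "D i" m X] i by (simp add: A_def X0 norm_minus_commute)
      moreover have "(norm (X (D i) - X i))\<^sup>2 \<le> real m * A"
        using norm_path_diff_sq_le[OF i, of X] by (simp add: A_def)
      ultimately show "e X i \<le> \<eta> * L\<^sup>2 * (K * (real m * A) + real m * A)"
        unfolding e_def using \<eta>_pos K by (intro mult_left_mono add_mono) auto
    qed
    also have "\<dots> = \<eta> * L\<^sup>2 * (real m)\<^sup>2 * (K + 1) * A"
      by (simp add: power2_eq_square algebra_simps)
    also have "\<dots> \<le> \<kappa> * A"
    proof (rule mult_right_mono[OF _ A])
      \<comment> \<open>As \<open>2 * \<eta> * \<kappa> = 1 - \<eta> * L\<close>, this is the step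
        size condition; \<open>K\<close> counts the snapshot distance and 1 the delay
        distance.\<close>
      have "2 * \<eta> * (\<eta> * L\<^sup>2 * (real m)\<^sup>2 * (K + 1)) \<le> 2 * \<eta> * \<kappa>"
        using parameters \<eta>_pos by (simp add: \<kappa>_def power2_eq_square algebra_simps)
      then show "\<eta> * L\<^sup>2 * (real m)\<^sup>2 * (K + 1) \<le> \<kappa>" using \<eta>_pos by simp
    qed
    finally have "(\<Sum>i<m. e X i) \<le> \<kappa> * A" .
    then show ?thesis
      by (simp only: w_def sum.distrib sum_subtractf A_def flip: sum_distrib_left)
  qed
  have "measure_pmf.expectation (I m) (\<lambda>X. obj (X m) + \<eta> / 2 * (\<Sum>i<m. (norm (G (X i)))\<^sup>2))
      \<le> measure_pmf.expectation (I m) (\<lambda>X. obj (X m) + (\<Sum>i<m. w X i))"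
    using w_sum by (intro expectation_mono_finite finI) auto
  also have "\<dots> \<le> obj xt" by (rule potential) simp
  finally show ?thesis .
qed

end

section \<open>Summation over epochs and the uniformly drawn output\<close>

theorem theorem2:
  fixes f :: "nat \<Rightarrow> real ^ 'd \<Rightarrow> real"
    and h P :: "real ^ 'd \<Rightarrow> real"
    and \<Omega> :: "(real ^ 'd) set"
    and x0 xstar :: "real ^ 'd"
    and n m S b bx :: nat
    and p :: "nat \<Rightarrow> nat \<Rightarrow> nat pmf"
    and D :: "nat \<Rightarrow> nat \<Rightarrow> nat"
    and L \<mu> \<tau> \<rho> \<eta> \<Delta> :: real
  assumes sizes: "n \<ge> 1" "m \<ge> 1" "S \<ge> 1" "b \<ge> 2" "bx \<ge> 2"
    and constants: "L > 0" "\<mu> > 0" "\<tau> > 0" "0 < \<rho>" "\<rho> < 1 / 2"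
    and \<eta>_def: "\<eta> = \<rho> / L"
    and \<Delta>_def: "\<Delta> = real CARD('d) / (4 * (2 ^ (b - 1) - 1)\<^sup>2)"
    and P_def: "P = (\<lambda>x. avg n f x + h x)"
    and domain: "convex \<Omega>"
    and h_convex: "convex_on \<Omega> h"
    and prox_exists: "\<forall>x. \<exists>y. is_arg_min (prox_objective \<eta> h x) (\<lambda>y. y \<in> \<Omega>) y"
    and optimal: "is_arg_min P (\<lambda>x. x \<in> \<Omega>) xstar"
    and start: "x0 \<in> \<Omega>"
    and f_differentiable: "\<forall>i\<in>{1..n}. \<forall>x\<in>\<Omega>. f i differentiable (at x)"
    and f_smooth: "\<forall>i\<in>{1..n}. \<forall>x\<in>\<Omega>. \<forall>y\<in>\<Omega>. norm (grad (f i) x - grad (f i) y) \<le> L * norm (x - y)"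
    and sampling: "\<forall>s<S. \<forall>t<m. set_pmf (p s t) \<subseteq> {1..n}"
    and unbiased: "\<forall>s<S. \<forall>t<m. \<forall>x\<in>\<Omega>.
          measure_pmf.expectation (p s t) (\<lambda>a. grad (f a) x) = grad (avg n f) x"
    and delay: "\<forall>s<S. \<forall>t<m. D s t \<le> t \<and> real t - real (D s t) \<le> \<tau>"
    and model_quantization_error: "\<forall>(xt, x) \<in> asylpg_delayed n f h \<Omega> \<eta> b bx p D m x0 S.
          measure_pmf.expectation (quantize_model bx xt x) (\<lambda>y. (norm (y - x))\<^sup>2)
            \<le> \<mu> * (norm (x - xt))\<^sup>2"
    and model_quantization_domain: "\<forall>(xt, x) \<in> asylpg_delayed n f h \<Omega> \<eta> b bx p D m x0 S.
          set_pmf (quantize_model bx xt x) \<subseteq> \<Omega>"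
    and parameters: "8 * \<rho>\<^sup>2 * (real m)\<^sup>2 * (\<mu> + 1) * (\<Delta> + 2)
          + 2 * \<rho>\<^sup>2 * (\<mu> + 1) * (\<Delta> + 2) * \<tau>\<^sup>2 + \<rho> \<le> 1"
  shows "measure_pmf.expectation (asylpg_output n f h \<Omega> \<eta> b bx p D m x0 S)
           (\<lambda>x. (norm (grad_mapping \<Omega> \<eta> (avg n f) h x))\<^sup>2)
         \<le> 2 * L * (P x0 - P xstar) / (\<rho> * (1 - 2 * \<rho>) * real (S * m))"
proof -
  have \<eta>: "\<eta> > 0" using constants by (simp add: \<eta>_def)
  interpret composite_problem n f h \<Omega> L \<eta>
    by unfold_locales
      (rule sizes(1) constants(1) \<eta> domain h_convex prox_exists[rule_format]
        f_differentiable[rule_format] f_smooth[rule_format]; assumption)+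
  define E where "E = asylpg_epochs n f h \<Omega> \<eta> b bx p D m x0"
  define R where "R s Z = (\<Sum>r<s::nat. \<Sum>t<m. (norm (G (Z r t)))\<^sup>2)" for s Z
  define K where "K = (\<mu> + 1) * (\<Delta> + 2)"
  have \<Delta>0: "\<Delta> \<ge> 0" by (simp add: \<Delta>_def)
  have finp: "finite (set_pmf (p s t))" if "s < S" "t < m" for s t
    by (rule finite_subset[of _ "{1..n}"]) (use sampling that in simp_all)
  have finE: "finite (set_pmf (E s))" if "s \<le> S" for s
    unfolding E_def by (rule finite_set_asylpg_epochs) (use that finp in auto)
  have memE: "fst \<xi> \<in> \<Omega>" if "\<xi> \<in> set_pmf (E s)" for s \<xi>
    using that
  proof (induction s arbitrary: \<xi>)
    case 0
    then show ?case using start by (simp add: E_def)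
  next
    case (Suc s)
    then obtain xt Z X where "(xt, Z) \<in> set_pmf (E s)" "fst \<xi> = X m"
      and X: "X \<in> set_pmf (asylpg_inner n f h \<Omega> \<eta> b bx (p s) (D s) xt m)"
      by (auto simp: E_def)
    then have "xt \<in> \<Omega>" using Suc.IH[of "(xt, Z)"] by simp
    then show ?case using asylpg_inner_mem(1)[OF _ X] \<open>fst \<xi> = X m\<close> by simp
  qed
  \<comment> \<open>From \<open>K \<ge> 2\<close> follows \<open>2 * (K + 1) \<le> 8 * K\<close>.
    With the nonnegativity of the summand in \<open>\<tau>\<close>, the assumed inequality yields
    the form that \<open>asylpg_epoch_descent\<close> takes.\<close>
  have "1 * 2 \<le> K" unfolding K_def using constants \<Delta>0 by (intro mult_mono) auto
  then have "2 * (real m)\<^sup>2 * (K + 1) \<le> (real m)\<^sup>2 * (8 * K)"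
    unfolding mult.commute[of 2] mult.assoc by (intro mult_left_mono) auto
  then have "\<rho>\<^sup>2 * (2 * (real m)\<^sup>2 * (K + 1)) \<le> \<rho>\<^sup>2 * ((real m)\<^sup>2 * (8 * K))"
    by (rule mult_left_mono) simp
  moreover have "8 * \<rho>\<^sup>2 * (real m)\<^sup>2 * K + 2 * \<rho>\<^sup>2 * K * \<tau>\<^sup>2 + \<rho> \<le> 1"
    using parameters by (simp add: K_def mult.assoc)
  moreover have "0 \<le> 2 * \<rho>\<^sup>2 * K * \<tau>\<^sup>2" using \<open>1 * 2 \<le> K\<close> by simp
  ultimately have "2 * \<rho>\<^sup>2 * (real m)\<^sup>2 * (K + 1) + \<rho> \<le> 1" by (simp add: algebra_simps)
  moreover have "\<eta> * L = \<rho>" using constants by (simp add: \<eta>_def)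
  ultimately have param: "2 * (\<eta> * L)\<^sup>2 * (real m)\<^sup>2 * ((\<mu> + 1) * (\<Delta> + 2) + 1) + \<eta> * L \<le> 1"
    by (simp add: K_def)
  \<comment> \<open>The last iterate of an epoch is the next snapshot, so the epoch bounds
    telescope.\<close>
  have epochs: "measure_pmf.expectation (E s) (\<lambda>(xt, Z). obj xt + \<eta> / 2 * R s Z) \<le> obj x0"
    if "s \<le> S" for s
    using that
  proof (induction s)
    case 0
    then show ?case by (simp add: E_def R_def)
  next
    case (Suc s)
    then have s: "s < S" by simp
    define J where "J = (\<lambda>xt. asylpg_inner n f h \<Omega> \<eta> b bx (p s) (D s) xt m)"
    have finJ: "finite (set_pmf (J xt))" for xt
      unfolding J_def by (rule finite_set_asylpg_inner) (use finp s in auto)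
    have ES: "E (Suc s) = E s \<bind> (\<lambda>(xt, Z). map_pmf (\<lambda>X. (X m, Z(s := X))) (J xt))"
      by (simp add: E_def J_def map_pmf_def)
    have "measure_pmf.expectation (E (Suc s)) (\<lambda>(xt, Z). obj xt + \<eta> / 2 * R (Suc s) Z)
        \<le> measure_pmf.expectation (E s) (\<lambda>(xt, Z). obj xt + \<eta> / 2 * R s Z)"
      unfolding ES
    proof (rule expectation_bind_le)
      show "finite (set_pmf (E s))" using finE s by simp
      fix \<xi> assume \<xi>: "\<xi> \<in> set_pmf (E s)"
      obtain xt Z where [simp]: "\<xi> = (xt, Z)" by (cases \<xi>)
      show "finite (set_pmf (case \<xi> of (xt, Z) \<Rightarrow> map_pmf (\<lambda>X. (X m, Z(s := X))) (J xt)))"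
        by (simp add: finJ)
      have delayed: "(xt, X (D s t)) \<in> asylpg_delayed n f h \<Omega> \<eta> b bx p D m x0 S"
        if "t < m" "X \<in> set_pmf (asylpg_inner n f h \<Omega> \<eta> b bx (p s) (D s) xt t)" for t X
        using that s \<xi> unfolding asylpg_delayed_def E_def by auto
      \<comment> \<open>\<open>R s\<close> reads only epochs before \<open>s\<close>, so recording
        \<open>X\<close> at \<open>s\<close> leaves it intact.\<close>
      have R_upd: "R (Suc s) (Z(s := X)) = R s Z + (\<Sum>i<m. (norm (G (X i)))\<^sup>2)" for X
        by (simp add: R_def)
      have "measure_pmf.expectation (J xt) (\<lambda>X. obj (X m) + \<eta> / 2 * (\<Sum>i<m. (norm (G (X i)))\<^sup>2)) \<le> obj xt"
        unfolding J_def
      proof (rule asylpg_epoch_descent[OF \<open>b \<ge> 2\<close> \<Delta>_def _ _ _ _ _ _ _ param])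
        show "xt \<in> \<Omega>" using memE[OF \<xi>] by simp
        show "set_pmf (quantize_model bx xt (X (D s t))) \<subseteq> \<Omega>"
          if "t < m" "X \<in> set_pmf (asylpg_inner n f h \<Omega> \<eta> b bx (p s) (D s) xt t)" for t X
          using model_quantization_domain delayed[OF that] by blast
        show "measure_pmf.expectation (quantize_model bx xt (X (D s t))) (\<lambda>y. (norm (y - X (D s t)))\<^sup>2)
            \<le> \<mu> * (norm (X (D s t) - xt))\<^sup>2"
          if "t < m" "X \<in> set_pmf (asylpg_inner n f h \<Omega> \<eta> b bx (p s) (D s) xt t)" for t X
          using model_quantization_error delayed[OF that] by blast
      qed (use s sampling unbiased delay constants in simp_all)
      moreover have "measure_pmf.expectation (J xt)
            (\<lambda>X. obj (X m) + \<eta> / 2 * R (Suc s) (Z(s := X)))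
          = measure_pmf.expectation (J xt) (\<lambda>X. obj (X m) + \<eta> / 2 * (\<Sum>i<m. (norm (G (X i)))\<^sup>2))
            + \<eta> / 2 * R s Z"
        unfolding R_upd by (simp add: integrable_measure_pmf_finite[OF finJ] algebra_simps)
      ultimately show "measure_pmf.expectation
            (case \<xi> of (xt, Z) \<Rightarrow> map_pmf (\<lambda>X. (X m, Z(s := X))) (J xt))
            (\<lambda>(xt, Z). obj xt + \<eta> / 2 * R (Suc s) Z)
          \<le> (case \<xi> of (xt, Z) \<Rightarrow> obj xt + \<eta> / 2 * R s Z)"
        by simp
    qed
    then show ?case using Suc by simp
  qed
  have opt: "obj xstar \<le> obj x" if "x \<in> \<Omega>" for x
    using optimal that by (auto simp: is_arg_min_def P_def not_less)
  define M where "M = measure_pmf.expectation (E S) (\<lambda>(xt, Z). R S Z)"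
  have intE: "integrable (measure_pmf (E S)) g" for g :: "_ \<Rightarrow> real"
    by (rule integrable_measure_pmf_finite[OF finE]) simp
  \<comment> \<open>The final snapshot lies in \<open>\<Omega>\<close>, so its objective value can
    be replaced by the optimal one.\<close>
  have "obj xstar + \<eta> / 2 * M = measure_pmf.expectation (E S) (\<lambda>\<xi>. obj xstar + \<eta> / 2 * (case \<xi> of (xt, Z) \<Rightarrow> R S Z))"
    by (simp add: M_def intE)
  also have "\<dots> \<le> measure_pmf.expectation (E S) (\<lambda>(xt, Z). obj xt + \<eta> / 2 * R S Z)"
    by (intro expectation_mono_finite finE) (simp_all add: split_beta opt memE)
  also have "\<dots> \<le> obj x0" by (rule epochs) simp
  finally have M: "M \<le> 2 * L * (obj x0 - obj xstar) / \<rho>"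
    using constants by (simp add: \<eta>_def field_simps)
  let ?ST = "{..<S} \<times> {..<m}"
  have ST: "?ST \<noteq> {}" "finite ?ST" using sizes by (auto simp: lessThan_empty_iff)
  have "measure_pmf.expectation (asylpg_output n f h \<Omega> \<eta> b bx p D m x0 S) (\<lambda>x. (norm (G x))\<^sup>2)
      = measure_pmf.expectation (E S) (\<lambda>\<xi>. measure_pmf.expectation
          (pmf_of_set ?ST) (\<lambda>(s, t). (norm (G (snd \<xi> s t)))\<^sup>2))"
  proof -
    have "asylpg_output n f h \<Omega> \<eta> b bx p D m x0 S
        = E S \<bind> (\<lambda>\<xi>. map_pmf (\<lambda>(s, t). snd \<xi> s t) (pmf_of_set ?ST))"
      unfolding asylpg_output_def E_def map_pmf_def
      by (intro bind_pmf_cong refl) (auto simp: case_prod_unfold)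
    then show ?thesis
      using ST by (simp add: expectation_bind_finite finE case_prod_unfold)
  qed
  also have "\<dots> = M / real (S * m)"
    using ST unfolding M_def
    by (simp add: integral_pmf_of_set R_def sum.cartesian_product case_prod_unfold)
  also have "\<dots> \<le> (2 * L * (obj x0 - obj xstar) / \<rho>) / real (S * m)"
    by (intro divide_right_mono M) simp
  \<comment> \<open>Dividing by \<open>1 - 2 * \<rho>\<close>, which lies strictly between 0 and 1,
    can only enlarge the bound, since optimality of \<open>xstar\<close> makes the numerator
    nonnegative.\<close>
  also have "\<dots> \<le> (2 * L * (obj x0 - obj xstar) / \<rho>) / (1 - 2 * \<rho>) / real (S * m)"
  proof (rule divide_right_mono)
    have "0 \<le> 2 * L * (obj x0 - obj xstar) / \<rho>" using opt[OF start] constants by simp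
    then show "2 * L * (obj x0 - obj xstar) / \<rho> \<le> 2 * L * (obj x0 - obj xstar) / \<rho> / (1 - 2 * \<rho>)"
      using constants mult_left_le[of "1 - 2 * \<rho>" "2 * L * (obj x0 - obj xstar) / \<rho>"]
      by (subst pos_le_divide_eq) simp_all
  qed simp
  finally show ?thesis by (simp add: P_def)
qed

end
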